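(* Let $a,b,c$ be real numbers with $a\ne 0$, $c>0$ and $b^2-4c>0$, and let $R^\pm=\frac12\left[b\pm\sqrt{b^2-4c}\right]$. Then for all $n\ge 1$, $$\Psi_n(x;a,b,c)=\begin{cases} a x\left(R^-\right)^{n-1}M_{n-1}^{(2)}\left(-\dfrac{ax}{\sqrt{b^2-4c}}-1;\dfrac{R^-}{R^+}\right), & b>0,\\[2ex] a x\left(R^+\right)^{n-1}M_{n-1}^{(2)}\left(\dfrac{ax}{\sqrt{b^2-4c}}-1;\dfrac{R^+}{R^-}\right), & b<0.\end{cases}$$
   Context: The polynomials $\Psi_n(x;a,b,c)$ are defined by the generating function $\exp[xf(z)]=\sum_{n=0}^\infty\Psi_n(x;a,b,c)\frac{z^n}{n!}$ with $$f(z)=\frac{a}{\sqrt{b^2-4c}}\ln\left[\frac{1-zR^-}{1-zR^+}\right]$$ (branch of the logarithm vanishing at $z=0$). The Meixner polynomials are normalized as $$M_n^{(\beta)}(x;\gamma)=(\beta)_n\,{}_2F_1\left(-n,-x;\beta;1-\tfrac1\gamma\right),\qquad \beta>0,\ 0<\gamma<1,$$ with generating function $\left(1-\frac t\gamma\right)^x(1-t)^{-\beta-x}=\sum_{n\ge0}M_n^{(\beta)}(x;\gamma)\frac{t^n}{n!}$. *)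

theory Defs
  imports
    "HOL-Analysis.Analysis"
    "HOL-Computational_Algebra.Polynomial"
begin

definition R_plus :: "real \<Rightarrow> real \<Rightarrow> real" where
  "R_plus b c = (b + sqrt (b\<^sup>2 - 4 * c)) / 2"

definition R_minus :: "real \<Rightarrow> real \<Rightarrow> real" where
  "R_minus b c = (b - sqrt (b\<^sup>2 - 4 * c)) / 2"

(* For z near 0 the argument of ln is near 1, hence positive, so the real logarithm is the
   branch that vanishes at z = 0. *)
definition psi_f :: "real \<Rightarrow> real \<Rightarrow> real \<Rightarrow> real \<Rightarrow> real" where
  "psi_f a b c z =
     a / sqrt (b\<^sup>2 - 4 * c) * ln ((1 - z * R_minus b c) / (1 - z * R_plus b c))"

definition is_Psi_family :: "real \<Rightarrow> real \<Rightarrow> real \<Rightarrow> (nat \<Rightarrow> real poly) \<Rightarrow> bool" where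
  "is_Psi_family a b c P \<longleftrightarrow>
     (\<forall>x. (\<lambda>z. exp (x * psi_f a b c z)) has_fps_expansion
            Abs_fps (\<lambda>n. poly (P n) x / fact n))"

(* Existence and uniqueness of the family: ex1_Psi_family below. *)
definition Psi :: "real \<Rightarrow> real \<Rightarrow> real \<Rightarrow> nat \<Rightarrow> real poly" where
  "Psi a b c = (THE P. is_Psi_family a b c P)"

(* The series terminates at the n-th term, so its value is meaningful
   although the argument 1 - 1/g may lie outside the unit disc. *)
definition Meixner :: "real \<Rightarrow> real \<Rightarrow> nat \<Rightarrow> real \<Rightarrow> real" where
  "Meixner \<beta> g n x =
     pochhammer \<beta> n * eval_fps (fps_hypergeo [- real n, - x] [\<beta>] 1) (1 - 1 / g)"

lemma fps_expansion_unique_real: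
  fixes f :: "real \<Rightarrow> real"
  assumes "f has_fps_expansion F" "f has_fps_expansion G"
  shows "F = G"
proof -
  define D where "D = F - G"
  have "(\<lambda>z. f z - f z) has_fps_expansion D"
    unfolding D_def by (intro has_fps_expansion_diff assms)
  then have rad: "fps_conv_radius D > 0" and ev: "eventually (\<lambda>z. eval_fps D z = 0) (nhds 0)"
    by (auto simp: has_fps_expansion_def)
  have "eventually (\<lambda>z. z \<in> eball 0 (fps_conv_radius D)) (nhds 0)"
    using rad by (intro eventually_nhds_in_open) (auto simp: zero_ereal_def)
  with ev have "eventually (\<lambda>z. (\<lambda>n. fps_nth D n * z ^ n) sums 0) (nhds 0)"
  proof eventually_elim
    case (elim z)
    then show ?case
      using sums_eval_fps[of z D] by (simp add: in_eball_iff)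
  qed
  then obtain s where s: "s > 0" "\<And>z. norm z < s \<Longrightarrow> (\<lambda>n. fps_nth D n * z ^ n) sums 0"
    by (auto simp: eventually_nhds_metric)
  have "fps_nth D n = 0" for n
  proof (induction n rule: less_induct)
    case (less n)
    have "(\<lambda>i. fps_nth D (i + n) * z ^ i) sums 0" if "z \<noteq> 0" "norm z < s" for z
    proof -
      have "(\<lambda>i. fps_nth D (i + n) * z ^ (i + n)) sums 0"
        using s(2)[OF that(2)] less by (subst sums_zero_iff_shift) auto
      then have "(\<lambda>i. fps_nth D (i + n) * z ^ (i + n) / z ^ n) sums (0 / z ^ n)"
        by (rule sums_divide)
      then show ?thesis using that(1) by (simp add: power_add)
    qed
    from powser_limit_0_strong[OF s(1) this]
    have "((\<lambda>_. 0) \<longlongrightarrow> fps_nth D n) (at (0::real))" by simp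
    then show ?case by (simp add: tendsto_const_iff)
  qed
  then show ?thesis by (simp add: D_def fps_eq_iff)
qed

lemma is_Psi_family_unique:
  assumes "is_Psi_family a b c P" "is_Psi_family a b c Q"
  shows "P = Q"
proof
  fix n
  have "poly (P n) x = poly (Q n) x" for x
    using fps_expansion_unique_real[OF assms[unfolded is_Psi_family_def, rule_format, of x]]
    by (simp add: fps_eq_iff)
  then show "P n = Q n"
    by (simp add: poly_eq_poly_eq_iff[symmetric] fun_eq_iff)
qed

lemma binomial_has_fps_expansion_real:
  fixes r s :: real
  shows "(\<lambda>z. (1 - z * r) powr s) has_fps_expansion Abs_fps (\<lambda>n. (s gchoose n) * (- r) ^ n)"
proof -
  have sums: "(\<lambda>n. (s gchoose n) * (- r) ^ n * z ^ n) sums (1 - z * r) powr s"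
    if "\<bar>z\<bar> < 1 / (\<bar>r\<bar> + 1)" for z
  proof -
    have "\<bar>z\<bar> * (\<bar>r\<bar> + 1) < 1" using that by (simp add: field_simps)
    then have "\<bar>z\<bar> * \<bar>r\<bar> + \<bar>z\<bar> < 1" by (simp add: distrib_left)
    then have "\<bar>z * (- r)\<bar> < 1" unfolding abs_mult abs_minus_cancel by linarith
    from gen_binomial_real[OF this, of s] show ?thesis
      unfolding power_mult_distrib by (simp add: mult_ac)
  qed
  define e where "e = 1 / (\<bar>r\<bar> + 1)"
  have e: "e > 0" by (simp add: e_def add_nonneg_pos)
  have "summable (\<lambda>n. fps_nth (Abs_fps (\<lambda>n. (s gchoose n) * (- r) ^ n)) n * (e / 2) ^ n)"
    using sums_summable[OF sums[of "e / 2"]] e by (simp flip: e_def)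
  then have "fps_conv_radius (Abs_fps (\<lambda>n. (s gchoose n) * (- r) ^ n)) \<ge> norm (e / 2)"
    unfolding fps_conv_radius_def by (rule conv_radius_geI)
  moreover have "0 < ereal (norm (e / 2))" using e by simp
  ultimately have "fps_conv_radius (Abs_fps (\<lambda>n. (s gchoose n) * (- r) ^ n)) > 0"
    by (rule less_le_trans[rotated])
  moreover have "eventually (\<lambda>z. \<bar>z\<bar> < e) (nhds (0::real))"
    using eventually_nhds_in_open[of "ball 0 e" "0::real"] e by (simp add: dist_real_def)
  then have "eventually (\<lambda>z. eval_fps (Abs_fps (\<lambda>n. (s gchoose n) * (- r) ^ n)) z
      = (1 - z * r) powr s) (nhds 0)"
    by eventually_elim (use sums in \<open>auto simp: eval_fps_def e_def sums_iff\<close>)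
  ultimately show ?thesis by (simp add: has_fps_expansion_def)
qed

lemma ex_Psi_family: "\<exists>P. is_Psi_family a b c P"
proof -
  define k where "k = a / sqrt (b\<^sup>2 - 4 * c)"
  define p where "p = R_plus b c"
  define m where "m = R_minus b c"
  define B where "B = (\<lambda>k n. smult (1 / fact n) (\<Prod>i<n. [:- real i, k:]))"
  have B: "poly (B k n) x = ((k * x) gchoose n)" for k n x
    by (simp add: B_def gbinomial_prod_rev poly_prod algebra_simps atLeast0LessThan)
  define P where "P = (\<lambda>n. smult (fact n)
     (\<Sum>i=0..n. smult ((- m) ^ i * (- p) ^ (n - i)) (B k i * B (- k) (n - i))))"
  have "(\<lambda>z. exp (x * psi_f a b c z)) has_fps_expansion
            Abs_fps (\<lambda>n. poly (P n) x / fact n)" for x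
  proof -
    have "(\<lambda>z. (1 - z * m) powr (k * x) * (1 - z * p) powr (- k * x)) has_fps_expansion
       Abs_fps (\<lambda>n. ((k * x) gchoose n) * (- m) ^ n) * Abs_fps (\<lambda>n. ((- k * x) gchoose n) * (- p) ^ n)"
      by (intro has_fps_expansion_mult binomial_has_fps_expansion_real)
    also have "Abs_fps (\<lambda>n. ((k * x) gchoose n) * (- m) ^ n) * Abs_fps (\<lambda>n. ((- k * x) gchoose n) * (- p) ^ n)
       = Abs_fps (\<lambda>n. poly (P n) x / fact n)"
      by (rule fps_ext, unfold fps_mult_nth fps_nth_Abs_fps P_def poly_smult poly_sum poly_mult B)
         (simp add: mult_ac)
    finally have 1: "(\<lambda>z. (1 - z * m) powr (k * x) * (1 - z * p) powr (- k * x)) has_fps_expansion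
       Abs_fps (\<lambda>n. poly (P n) x / fact n)" .
    have pos: "eventually (\<lambda>z. 1 - z * q > 0) (nhds (0::real))" for q
      by (rule order_tendstoD(1)[where y = 1])
         (auto intro!: tendsto_eq_intros filterlim_ident)
    have "eventually (\<lambda>z. (1 - z * m) powr (k * x) * (1 - z * p) powr (- k * x)
        = exp (x * psi_f a b c z)) (nhds 0)"
      using pos[of m] pos[of p]
      unfolding psi_f_def k_def[symmetric] p_def[symmetric] m_def[symmetric]
      by eventually_elim (simp add: powr_def ln_div exp_add[symmetric] right_diff_distrib)
    with 1 show ?thesis
      unfolding has_fps_expansion_def by (auto elim: eventually_elim2)
  qed
  then show ?thesis unfolding is_Psi_family_def by blast
qed

lemma ex1_Psi_family: "\<exists>!P. is_Psi_family a b c P"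
  using ex_Psi_family is_Psi_family_unique by blast

lemma Psi_generating_function:
  "(\<lambda>z. exp (x * psi_f a b c z)) has_fps_expansion Abs_fps (\<lambda>n. poly (Psi a b c n) x / fact n)"
  using theI'[OF ex1_Psi_family[of a b c]] by (simp add: Psi_def is_Psi_family_def)

end

theory Submission
  imports Defs
begin

text \<open>
  Since \<open>f'(z) = a / ((1 - z R\<^sup>-) (1 - z R\<^sup>+))\<close>, differentiating \<open>exp (x f(z))\<close> in \<open>z\<close> gives
  \<open>a x (1 - z R\<^sup>-)\<^bsup>s - 1\<^esup> (1 - z R\<^sup>+)\<^bsup>- s - 1\<^esup>\<close> with \<open>s = a x / sqrt (b\<^sup>2 - 4 c)\<close>. The exponents add up to
  \<open>- 2\<close>, so with \<open>t = z R\<^sup>-\<close> or \<open>t = z R\<^sup>+\<close> this is a Meixner generating function with \<open>\<beta> = 2\<close>.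
  The Meixner generating function itself reduces, after expanding powers of \<open>- 1 / \<gamma> = w - 1\<close>
  in \<open>w = 1 - 1 / \<gamma>\<close>, to Vandermonde's convolution for each coefficient of \<open>w\<close>.
\<close>

text \<open>Reflecting each Pochhammer symbol into a binomial coefficient and using
  \<open>(\<beta>)_n / (\<beta>)_k = (\<beta> + k)_(n-k)\<close> turns the hypergeometric sum into
  the right-hand form of \<open>gbinomial_convolution_shift\<close>. Positivity of
  \<open>\<beta>\<close> makes the denominators nonzero.\<close>

lemma Meixner_altdef:
  assumes "\<beta> > 0"
  shows "Meixner \<beta> g n x =
    fact n * (\<Sum>k\<le>n. (x gchoose k) * (1 - 1 / g) ^ k * ((-1) ^ (n - k) * ((- \<beta> - real k) gchoose (n - k))))"
proof -
  define w where "w = 1 - 1 / g"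
  have "eval_fps (fps_hypergeo [- real n, - x] [\<beta>] 1) w =
      (\<Sum>k\<le>n. pochhammer (- real n) k * pochhammer (- x) k / (pochhammer \<beta> k * fact k) * w ^ k)"
    \<comment> \<open>The factor \<open>(-n)_k\<close> vanishes for \<open>k > n\<close>, so the
      infinite sum is finite.\<close>
    unfolding eval_fps_def
    by (subst suminf_finite[of "{..n}"]) (auto simp: pochhammer_of_nat_eq_0_iff)
  then have "Meixner \<beta> g n x = (\<Sum>k\<le>n. pochhammer \<beta> n *
      (pochhammer (- real n) k * pochhammer (- x) k / (pochhammer \<beta> k * fact k) * w ^ k))"
    by (simp add: Meixner_def w_def sum_distrib_left)
  also have "\<dots> = (\<Sum>k\<le>n. fact n *
      ((x gchoose k) * w ^ k * ((-1) ^ (n - k) * ((- \<beta> - real k) gchoose (n - k)))))"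
  proof (rule sum.cong)
    fix k assume "k \<in> {..n}"
    then have kn: "k \<le> n" by simp
    have "pochhammer \<beta> k > 0" using assms by (rule pochhammer_pos)
    have eq1: "pochhammer \<beta> n = pochhammer \<beta> k * pochhammer (\<beta> + real k) (n - k)"
      by (rule pochhammer_product[OF kn])
    have neg: "pochhammer (- y) m = (-1) ^ m * fact m * (y gchoose m)" for y :: real and m
      by (simp add: gbinomial_pochhammer flip: power_mult_distrib)
    have eq2: "pochhammer (\<beta> + real k) (n - k) =
        (-1) ^ (n - k) * fact (n - k) * ((- \<beta> - real k) gchoose (n - k))"
      using neg[of "- \<beta> - real k" "n - k"] by (simp add: add.commute)
    \<comment> \<open>Both reflections contribute a sign \<open>(-1)^k\<close>; these
      cancel.\<close>
    have "pochhammer (- real n) k * pochhammer (- x) k =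
        (-1 * -1) ^ k * (fact k * (real n gchoose k)) * (fact k * (x gchoose k))"
      unfolding neg power_mult_distrib by (simp only: mult_ac)
    also have "fact k * (real n gchoose k) = fact n / fact (n - k)"
      using binomial_fact[OF kn, where ?'a = real] by (simp add: binomial_gbinomial)
    finally have eq3: "pochhammer (- real n) k * pochhammer (- x) k =
        fact n / fact (n - k) * (fact k * (x gchoose k))" by simp
    show "pochhammer \<beta> n *
        (pochhammer (- real n) k * pochhammer (- x) k / (pochhammer \<beta> k * fact k) * w ^ k) =
      fact n * ((x gchoose k) * w ^ k * ((-1) ^ (n - k) * ((- \<beta> - real k) gchoose (n - k))))"
      unfolding eq1 eq2 eq3 using \<open>pochhammer \<beta> k > 0\<close> by (simp add: field_simps)
  qed simp
  finally show ?thesis by (simp add: w_def sum_distrib_left)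
qed

text \<open>Both sides are the coefficient of \<open>t^n\<close> in
  \<open>(1 + (w-1) t)^x (1-t)^y\<close>. The right one comes from writing the first base as
  \<open>(1-t) + w t\<close> and expanding in powers of \<open>w t\<close>, which leaves
  \<open>(1-t)^(x+y-j)\<close> beside \<open>(w t)^j\<close>.\<close>

lemma gbinomial_convolution_shift:
  fixes x y w :: "'a :: field_char_0"
  shows "(\<Sum>k\<le>n. (x gchoose k) * (w - 1) ^ k * ((-1) ^ (n - k) * (y gchoose (n - k)))) =
         (\<Sum>j\<le>n. (x gchoose j) * w ^ j * ((-1) ^ (n - j) * ((x + y - of_nat j) gchoose (n - j))))"
proof -
  have "(\<Sum>k\<le>n. (x gchoose k) * (w - 1) ^ k * ((-1) ^ (n - k) * (y gchoose (n - k)))) =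
        (\<Sum>k\<le>n. \<Sum>j\<le>k. w ^ j * (-1) ^ (n - j) *
           ((x gchoose k) * (of_nat k gchoose j) * (y gchoose (n - k))))"
  proof (rule sum.cong)
    fix k assume "k \<in> {..n}"
    then have kn: "k \<le> n" by simp
    have "(w - 1) ^ k = (\<Sum>j\<le>k. (of_nat k gchoose j) * w ^ j * (-1) ^ (k - j))"
      using binomial_ring[of w "-1" k] by (simp add: binomial_gbinomial)
    then have "(x gchoose k) * (w - 1) ^ k * ((-1) ^ (n - k) * (y gchoose (n - k))) =
        (\<Sum>j\<le>k. w ^ j * ((-1) ^ (k - j) * (-1) ^ (n - k)) *
          ((x gchoose k) * (of_nat k gchoose j) * (y gchoose (n - k))))"
      by (simp add: sum_distrib_left sum_distrib_right mult_ac)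
    also have "\<dots> = (\<Sum>j\<le>k. w ^ j * (-1) ^ (n - j) *
        ((x gchoose k) * (of_nat k gchoose j) * (y gchoose (n - k))))"
      using kn by (intro sum.cong) (simp_all flip: power_add)
    finally show "(x gchoose k) * (w - 1) ^ k * ((-1) ^ (n - k) * (y gchoose (n - k))) =
        (\<Sum>j\<le>k. w ^ j * (-1) ^ (n - j) * ((x gchoose k) * (of_nat k gchoose j) * (y gchoose (n - k))))" .
  qed simp
  \<comment> \<open>Trinomial revision leaves \<open>k\<close> only in two binomial coefficients
    whose lower indices add up to \<open>n - j\<close>, so after exchanging the sums Vandermonde
    applies to the sum over \<open>k\<close>.\<close>
  also have "\<dots> = (\<Sum>k\<le>n. \<Sum>j\<le>k. w ^ j * (-1) ^ (n - j) *
           ((x gchoose j) * ((x - of_nat j) gchoose (k - j)) * (y gchoose (n - k))))"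
    by (simp add: gbinomial_trinomial_revision)
  also have "\<dots> = (\<Sum>j\<le>n. \<Sum>k=j..n. w ^ j * (-1) ^ (n - j) *
           ((x gchoose j) * ((x - of_nat j) gchoose (k - j)) * (y gchoose (n - k))))"
    unfolding sum.Sigma[OF finite_atMost ballI[OF finite_atMost]]
      sum.Sigma[OF finite_atMost ballI[OF finite_atLeastAtMost]]
    by (rule sum.reindex_bij_witness[of _ "\<lambda>(j, k). (k, j)" "\<lambda>(k, j). (j, k)"]) auto
  also have "\<dots> = (\<Sum>j\<le>n. (x gchoose j) * w ^ j * ((-1) ^ (n - j) * ((x + y - of_nat j) gchoose (n - j))))"
  proof (rule sum.cong)
    fix j assume "j \<in> {..n}"
    then have jn: "j \<le> n" by simp
    have "(\<Sum>k=j..n. ((x - of_nat j) gchoose (k - j)) * (y gchoose (n - k))) =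
          (\<Sum>k=0..n-j. ((x - of_nat j) gchoose k) * (y gchoose (n - j - k)))"
      using jn by (intro sum.reindex_bij_witness[of _ "\<lambda>k. k + j" "\<lambda>k. k - j"]) auto
    also have "\<dots> = (x - of_nat j + y) gchoose (n - j)"
      by (rule gbinomial_Vandermonde)
    finally have vandermonde: "(\<Sum>k=j..n. ((x - of_nat j) gchoose (k - j)) * (y gchoose (n - k))) =
        (x + y - of_nat j) gchoose (n - j)" by (simp add: algebra_simps)
    have "(\<Sum>k=j..n. w ^ j * (-1) ^ (n - j) *
           ((x gchoose j) * ((x - of_nat j) gchoose (k - j)) * (y gchoose (n - k)))) =
        (x gchoose j) * w ^ j * (-1) ^ (n - j) *
        (\<Sum>k=j..n. ((x - of_nat j) gchoose (k - j)) * (y gchoose (n - k)))"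
      unfolding sum_distrib_left by (simp only: mult_ac)
    then show "(\<Sum>k=j..n. w ^ j * (-1) ^ (n - j) *
           ((x gchoose j) * ((x - of_nat j) gchoose (k - j)) * (y gchoose (n - k)))) =
        (x gchoose j) * w ^ j * ((-1) ^ (n - j) * ((x + y - of_nat j) gchoose (n - j)))"
      unfolding vandermonde by (simp only: mult_ac)
  qed simp
  finally show ?thesis .
qed

text \<open>With \<open>z\<close> scaled by \<open>r\<close>, i.e. \<open>t = r z\<close> and \<open>\<gamma> = r / q\<close> in the usual generating function.\<close>

lemma Meixner_generating_function:
  assumes "\<beta> > 0" "r \<noteq> 0"
  shows "(\<lambda>z. (1 - z * q) powr x * (1 - z * r) powr (- \<beta> - x)) has_fps_expansion
           Abs_fps (\<lambda>n. r ^ n * Meixner \<beta> (r / q) n x / fact n)"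
proof -
  \<comment> \<open>This is \<open>1 - 1/\<gamma>\<close> for \<open>\<gamma> = r / q\<close>. It
    stays correct for \<open>q = 0\<close>, where division by zero gives \<open>\<gamma> = 0\<close>
    and both expressions equal 1.\<close>
  define w where "w = 1 - q / r"
  have q: "q = - r * (w - 1)" using assms by (simp add: w_def field_simps)
  have "(\<Sum>k=0..n. (x gchoose k) * (- q) ^ k * (((- \<beta> - x) gchoose (n - k)) * (- r) ^ (n - k))) =
      r ^ n * Meixner \<beta> (r / q) n x / fact n" for n
  proof -
    have "(\<Sum>k=0..n. (x gchoose k) * (- q) ^ k * (((- \<beta> - x) gchoose (n - k)) * (- r) ^ (n - k))) =
        (\<Sum>k\<le>n. r ^ n * ((x gchoose k) * (w - 1) ^ k * ((-1) ^ (n - k) * ((- \<beta> - x) gchoose (n - k)))))"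
    proof (rule sum.cong)
      fix k assume "k \<in> {..n}"
      then have "r ^ n = r ^ k * r ^ (n - k)" by (simp flip: power_add)
      moreover have "(- q) ^ k = r ^ k * (w - 1) ^ k" by (simp add: q flip: power_mult_distrib)
      moreover have "(- r) ^ (n - k) = (-1) ^ (n - k) * r ^ (n - k)" by (rule power_minus)
      ultimately show "(x gchoose k) * (- q) ^ k * (((- \<beta> - x) gchoose (n - k)) * (- r) ^ (n - k)) =
          r ^ n * ((x gchoose k) * (w - 1) ^ k * ((-1) ^ (n - k) * ((- \<beta> - x) gchoose (n - k))))"
        by (simp only: mult_ac)
    qed auto
    \<comment> \<open>For \<open>y = -\<beta> - x\<close> the upper index \<open>x + y - j\<close>
      becomes \<open>-\<beta> - j\<close>, as in \<open>Meixner_altdef\<close>.\<close>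
    also have "\<dots> = r ^ n * Meixner \<beta> (r / q) n x / fact n"
      unfolding sum_distrib_left[symmetric] gbinomial_convolution_shift[of x w n "- \<beta> - x"]
      by (simp add: Meixner_altdef[OF assms(1)] w_def)
    finally show ?thesis .
  qed
  then have "Abs_fps (\<lambda>n. (x gchoose n) * (- q) ^ n) * Abs_fps (\<lambda>n. ((- \<beta> - x) gchoose n) * (- r) ^ n) =
      Abs_fps (\<lambda>n. r ^ n * Meixner \<beta> (r / q) n x / fact n)"
    by (intro fps_ext) (simp add: fps_mult_nth)
  with has_fps_expansion_mult[OF binomial_has_fps_expansion_real[of q x]
      binomial_has_fps_expansion_real[of r "- \<beta> - x"]]
  show ?thesis by simp
qed

lemma eventually_one_minus_mult_pos: "eventually (\<lambda>z. 1 - z * q > 0) (nhds (0::real))"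
  by (rule order_tendstoD(1)[where y = 1]) (auto intro!: tendsto_eq_intros filterlim_ident)

text \<open>The exponential equals \<open>(1 - z R_minus)^s (1 - z R_plus)^(-s)\<close>, and the
  derivative of \<open>psi_f\<close> lowers both exponents by one.\<close>

lemma deriv_exp_psi_f:
  fixes a b c x z :: real
  assumes "b\<^sup>2 - 4 * c > 0" "1 - z * R_minus b c > 0" "1 - z * R_plus b c > 0"
  defines "s \<equiv> a * x / sqrt (b\<^sup>2 - 4 * c)"
  shows "deriv (\<lambda>z. exp (x * psi_f a b c z)) z =
    a * x * ((1 - z * R_minus b c) powr (s - 1) * (1 - z * R_plus b c) powr (- s - 1))"
proof -
  define d where "d = sqrt (b\<^sup>2 - 4 * c)"
  define p where "p = R_plus b c"
  define m where "m = R_minus b c"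
  have d: "d > 0" "p - m = d"
    using assms(1) by (simp_all add: d_def p_def m_def R_plus_def R_minus_def field_simps)
  have pos: "1 - z * m > 0" "1 - z * p > 0" using assms by (simp_all add: p_def m_def)
  have "((\<lambda>z. a / d * ln ((1 - z * m) / (1 - z * p))) has_real_derivative
      a / d * ((1 - z * p) / (1 - z * m) * ((- m * (1 - z * p) + (1 - z * m) * p) / (1 - z * p)\<^sup>2))) (at z)"
    using pos d(1) by (auto intro!: derivative_eq_intros simp: power2_eq_square mult_ac)
  \<comment> \<open>The quotient-rule numerator collapses to \<open>p - m = d\<close>, which cancels
    the \<open>d\<close> in the prefactor \<open>a / d\<close>.\<close>
  also have "- m * (1 - z * p) + (1 - z * m) * p = d"
    using d by (simp add: algebra_simps)
  also have "a / d * ((1 - z * p) / (1 - z * m) * (d / (1 - z * p)\<^sup>2)) = a / ((1 - z * m) * (1 - z * p))"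
    using pos d by (simp add: power2_eq_square)
  finally have "(psi_f a b c has_real_derivative a / ((1 - z * m) * (1 - z * p))) (at z)"
    by (simp add: psi_f_def[abs_def] d_def p_def m_def)
  then have "((\<lambda>z. exp (x * psi_f a b c z)) has_real_derivative
      exp (x * psi_f a b c z) * (x * (a / ((1 - z * m) * (1 - z * p))))) (at z)"
    by (auto intro!: derivative_eq_intros)
  then have "deriv (\<lambda>z. exp (x * psi_f a b c z)) z =
      exp (x * psi_f a b c z) * (x * (a / ((1 - z * m) * (1 - z * p))))"
    by (rule DERIV_imp_deriv)
  also have "exp (x * psi_f a b c z) = (1 - z * m) powr s * (1 - z * p) powr (- s)"
    using pos
    by (simp add: psi_f_def powr_def ln_div s_def p_def m_def right_diff_distrib mult_ac flip: exp_add)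
  finally show ?thesis
    using pos by (simp add: powr_diff p_def m_def)
qed

lemma Psi_derivative_generating_function:
  fixes a b c x :: real
  assumes "b\<^sup>2 - 4 * c > 0"
  defines "s \<equiv> a * x / sqrt (b\<^sup>2 - 4 * c)"
  shows "(\<lambda>z. a * x * ((1 - z * R_minus b c) powr (s - 1) * (1 - z * R_plus b c) powr (- s - 1)))
    has_fps_expansion Abs_fps (\<lambda>n. poly (Psi a b c (Suc n)) x / fact n)"
proof -
  \<comment> \<open>Differentiating an exponential generating function shifts its coefficients by
    one, since \<open>(n+1) / (n+1)! = 1 / n!\<close>.\<close>
  have "fps_deriv (Abs_fps (\<lambda>n. poly (Psi a b c n) x / fact n)) =
      Abs_fps (\<lambda>n. poly (Psi a b c (Suc n)) x / fact n)"
    by (intro fps_ext) (simp add: field_simps del: of_nat_Suc)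
  with has_fps_expansion_deriv[OF Psi_generating_function[of x a b c]]
  have "deriv (\<lambda>z. exp (x * psi_f a b c z)) has_fps_expansion
      Abs_fps (\<lambda>n. poly (Psi a b c (Suc n)) x / fact n)" by simp
  \<comment> \<open>Agreement near 0, where both bases are positive, is enough for an expansion at
    0.\<close>
  moreover have "eventually (\<lambda>z. deriv (\<lambda>z. exp (x * psi_f a b c z)) z =
      a * x * ((1 - z * R_minus b c) powr (s - 1) * (1 - z * R_plus b c) powr (- s - 1))) (nhds 0)"
    using eventually_one_minus_mult_pos[of "R_minus b c"] eventually_one_minus_mult_pos[of "R_plus b c"]
    by eventually_elim (simp add: deriv_exp_psi_f[OF assms(1)] s_def)
  ultimately show ?thesis
    unfolding has_fps_expansion_def by (auto elim: eventually_elim2)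
qed

text \<open>Covers both cases of the theorem: \<open>r\<close> is the root used for scaling,
  \<open>q\<close> the other root. The result follows by comparing coefficients of two expansions of
  the same function.\<close>

lemma poly_Psi_Suc_eqI:
  assumes "b\<^sup>2 - 4 * c > 0" "r \<noteq> 0"
    and "\<And>z. (1 - z * q) powr y * (1 - z * r) powr (- 2 - y) =
           (1 - z * R_minus b c) powr (a * x / sqrt (b\<^sup>2 - 4 * c) - 1) *
           (1 - z * R_plus b c) powr (- (a * x / sqrt (b\<^sup>2 - 4 * c)) - 1)"
  shows "poly (Psi a b c (Suc n)) x = a * x * r ^ n * Meixner 2 (r / q) n y"
proof -
  have "(\<lambda>z. a * x * ((1 - z * q) powr y * (1 - z * r) powr (- 2 - y))) has_fps_expansion
      fps_const (a * x) * Abs_fps (\<lambda>n. r ^ n * Meixner 2 (r / q) n y / fact n)"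
    using assms(2) by (intro has_fps_expansion_cmult_left Meixner_generating_function) auto
  then have "Abs_fps (\<lambda>n. poly (Psi a b c (Suc n)) x / fact n) =
      fps_const (a * x) * Abs_fps (\<lambda>n. r ^ n * Meixner 2 (r / q) n y / fact n)"
    unfolding assms(3)
    by (rule fps_expansion_unique_real[OF Psi_derivative_generating_function[OF assms(1)]])
  from arg_cong[where f = "\<lambda>F. fps_nth F n", OF this] show ?thesis by simp
qed

lemma R_minus_mult_R_plus:
  assumes "b\<^sup>2 - 4 * c \<ge> 0"
  shows "R_minus b c * R_plus b c = c"
  using assms by (simp add: R_minus_def R_plus_def field_simps power2_eq_square)

theorem corollary19:
  fixes a b c x :: real and n :: nat
  assumes "a \<noteq> 0" and "c > 0" and "b\<^sup>2 - 4 * c > 0" and "n \<ge> 1"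
  shows "(b > 0 \<longrightarrow>
            poly (Psi a b c n) x =
              a * x * R_minus b c ^ (n - 1) *
              Meixner 2 (R_minus b c / R_plus b c) (n - 1) (- (a * x / sqrt (b\<^sup>2 - 4 * c)) - 1)) \<and>
         (b < 0 \<longrightarrow>
            poly (Psi a b c n) x =
              a * x * R_plus b c ^ (n - 1) *
              Meixner 2 (R_plus b c / R_minus b c) (n - 1) (a * x / sqrt (b\<^sup>2 - 4 * c) - 1))"
proof -
  obtain k where n: "n = Suc k" using assms(4) by (cases n) auto
  \<comment> \<open>The product of the roots is \<open>c > 0\<close>.\<close>
  have "R_minus b c \<noteq> 0" "R_plus b c \<noteq> 0"
    using R_minus_mult_R_plus[of b c] assms by auto
  \<comment> \<open>The exponents \<open>s - 1\<close> and \<open>- s - 1\<close> are exchanged by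
    \<open>y \<mapsto> - 2 - y\<close>, so either can serve as the Meixner argument:
    \<open>y = - s - 1\<close> with \<open>r = R_minus b c\<close>, or \<open>y = s - 1\<close> with
    \<open>r = R_plus b c\<close>.\<close>
  moreover have "- 2 - (s - 1) = - s - 1" "- 2 - (- s - 1) = s - 1" for s :: real
    by simp_all
  ultimately show ?thesis
    unfolding n diff_Suc_1
    by (intro conjI impI poly_Psi_Suc_eqI[OF assms(3)]) (simp_all only: mult.commute not_False_eq_True)
qed

end
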